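(* Let $n,k$ be positive integers and let $u,v$ be distinct vertices of the Kneser graph $K(2n+k,n)$, with $s=|u\cap v|$. Then $\mathit{dist}(u,v)=\mathit{diam}(K(2n+k,n))$ if and only if $$\left(\left\lceil \frac{n-1}{2k}\right\rceil-1\right)k+1\;\le\; s\;\le\;\left(\left\lceil \frac{n-1}{2k}\right\rceil-1\right)k+1+H(n,k),$$ where $$H(n,k)=\begin{cases}\max\{(n\bmod k)+k-2,\,0\}, & \text{if } 0\le n\bmod k\le 1,\\ (n\bmod k)-2, & \text{if } 2\le n\bmod k\le k-1.\end{cases}$$
   Context: For positive integers $n,k$, the Kneser graph $K(2n+k,n)$ has as vertex set all $n$-element subsets of $\{1,\ldots,2n+k\}$, two vertices $u,v$ being adjacent iff $u\cap v=\emptyset$. $\mathit{dist}(u,v)$ is the length (number of edges) of a shortest path between $u$ and $v$, and $\mathit{diam}(G)=\max_{u,v}\mathit{dist}(u,v)$. *)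

theory Defs
  imports "Graph_Theory.Graph_Theory" "HOL-Library.Extended_Nat" Complex_Main
begin

text \<open>An undirected edge is represented, as for the locale \<^locale>\<open>pair_graph\<close>, by its two
  orientations.\<close>

definition kneser_graph :: "nat \<Rightarrow> nat \<Rightarrow> nat set pair_pre_digraph" where
  "kneser_graph m n =
    (let V = {A. A \<subseteq> {1..m} \<and> card A = n}
     in \<lparr> pverts = V, parcs = {(A, B). A \<in> V \<and> B \<in> V \<and> A \<inter> B = {}} \<rparr>)"

lemma pair_graph_kneser:
  assumes "n > 0"
  shows "pair_graph (kneser_graph m n)"
proof -
  let ?G = "kneser_graph m n"
  have V: "pverts ?G = {A. A \<subseteq> {1..m} \<and> card A = n}"
    and E: "\<And>A B. (A, B) \<in> parcs ?G \<longleftrightarrow> A \<in> pverts ?G \<and> B \<in> pverts ?G \<and> A \<inter> B = {}"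
    by (simp_all add: kneser_graph_def Let_def)
  have fin: "finite (pverts ?G)"
    unfolding V by (rule finite_subset[of _ "Pow {1..m}"]) auto
  have "parcs ?G \<subseteq> pverts ?G \<times> pverts ?G"
    using E by auto
  then have finE: "finite (parcs ?G)"
    using fin by (meson finite_SigmaI finite_subset)
  have loop: "A \<noteq> B" if "(A, B) \<in> parcs ?G" for A B
    using that assms unfolding E V by auto
  have "sym (parcs ?G)"
    by (rule symI) (simp add: E Int_commute)
  then have sy: "symmetric (with_proj ?G)"
    by (simp add: symmetric_def arcs_ends_def arc_to_ends_def)
  show ?thesis
  proof
    show "fst e \<in> pverts ?G" "snd e \<in> pverts ?G" "fst e \<noteq> snd e" if "e \<in> parcs ?G" for e
      using that loop E by (cases e; simp)+
  qed (rule fin finE sy)+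
qed

text \<open>The value is \<^term>\<open>\<infinity>\<close> if there is no path.\<close>

definition graph_dist :: "('a, 'b) pre_digraph \<Rightarrow> 'a \<Rightarrow> 'a \<Rightarrow> enat" where
  "graph_dist G u v = (INF p \<in> {p. pre_digraph.apath G u p v}. enat (length p))"

text \<open>Only meaningful if \<^term>\<open>verts G\<close> is finite and nonempty.\<close>

definition graph_diam :: "('a, 'b) pre_digraph \<Rightarrow> enat" where
  "graph_diam G = Max {graph_dist G u v | u v. u \<in> verts G \<and> v \<in> verts G}"

definition H :: "nat \<Rightarrow> nat \<Rightarrow> int" where
  "H n k = (if n mod k \<le> 1 then max (int (n mod k) + int k - 2) 0 else int (n mod k) - 2)"

end

theory Submission
  imports Defs
begin

text \<open>
  Write \<open>s\<close> for the size of the intersection of \<open>u\<close> and \<open>v\<close>. Two steps of a walk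
  replace at most \<open>k\<close> elements of a vertex and can replace any \<open>k\<close> of them by any \<open>k\<close> others,
  so a walk of length \<open>2 * m\<close> from \<open>u\<close> to \<open>v\<close> exists iff \<open>n - s \<le> m * k\<close>, and one of length
  \<open>2 * m + 1\<close> exists iff \<open>s \<le> m * k\<close>. If \<open>e\<close> is \<open>(n - 1) / k\<close> rounded up, then for every \<open>s\<close>
  one of the lengths \<open>e\<close> and \<open>e + 1\<close> is feasible. The diameter is \<open>e + 1\<close>, and the
  distance equals it iff no length up to \<open>e\<close> is feasible. Feasibility is monotone within
  each parity, so this gives one lower and one upper bound on \<open>s\<close>.
\<close>

section \<open>Distances through walks and powers of the arc relation\<close>

lemma (in wf_digraph) length_awalk_to_apath:
  assumes "awalk u p v"
  shows "length (awalk_to_apath p) \<le> length p"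
  using assms
proof (induct rule: awalk_to_apath_induct)
  case (path p)
  then have "awalk_to_apath p = p"
    by (auto simp: awalk_to_apath.simps)
  then show ?case by simp
next
  case (decomp p q r s)
  \<comment> \<open>One step of \<open>awalk_to_apath\<close> turns \<open>q @ r @ s\<close> into
    \<open>q @ s\<close>, cutting out the closed part \<open>r\<close>.\<close>
  then have "p = q @ r @ s"
    by (metis awalk_cyc_decompE)
  then show ?case
    using decomp step_awalk_to_apath[of _ p _ q r s] by simp
qed

text \<open>The infimum ranges over paths, but cutting cycles out of a walk never lengthens it, so
  walks serve equally well.\<close>

lemma (in wf_digraph) graph_dist_le_iff:
  "graph_dist G u v \<le> enat d \<longleftrightarrow> (\<exists>p. awalk u p v \<and> length p \<le> d)"
proof
  let ?L = "(\<lambda>p. enat (length p)) ` {p. apath u p v}"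
  assume le: "graph_dist G u v \<le> enat d"
  \<comment> \<open>Without paths the infimum would be \<infinity>; a nonempty set of
    \<open>enat\<close> attains its infimum.\<close>
  then have "?L \<noteq> {}"
    by (auto simp: graph_dist_def Inf_enat_def split: if_splits)
  then have "Inf ?L \<in> ?L"
    by (metis Inf_enat_def LeastI ex_in_conv)
  then show "\<exists>p. awalk u p v \<and> length p \<le> d"
    using le by (auto simp: graph_dist_def dest: awalkI_apath)
next
  assume "\<exists>p. awalk u p v \<and> length p \<le> d"
  then obtain p where p: "awalk u p v" "length p \<le> d" by blast
  then have "graph_dist G u v \<le> enat (length (awalk_to_apath p))"
    unfolding graph_dist_def by (intro INF_lower) (auto intro: apath_awalk_to_apath)
  also have "\<dots> \<le> enat d"
    using length_awalk_to_apath[OF p(1)] p(2) by simp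
  finally show "graph_dist G u v \<le> enat d" .
qed

text \<open>Relation powers let walks be composed without lists of arcs. That \<open>u\<close> is a
  vertex matters at length 0, where the power is the identity on the whole type.\<close>

lemma (in wf_digraph) awalk_length_iff_relpow:
  assumes "u \<in> verts G"
  shows "(\<exists>p. awalk u p v \<and> length p = l) \<longleftrightarrow> (u, v) \<in> arcs_ends G ^^ l"
  using assms
proof (induction l arbitrary: u)
  case 0
  then show ?case by (auto simp: awalk_Nil_iff)
next
  case (Suc l)
  show ?case
  proof
    assume "\<exists>p. awalk u p v \<and> length p = Suc l"
    then obtain e p where e: "e \<in> arcs G" "u = tail G e" "awalk (head G e) p v" "length p = l"
      by (auto simp: length_Suc_conv awalk_Cons_iff)
    then have "(head G e, v) \<in> arcs_ends G ^^ l"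
      using Suc.IH[of "head G e"] by auto
    moreover have "(u, head G e) \<in> arcs_ends G"
      using e by (auto simp: arcs_ends_def arc_to_ends_def)
    ultimately show "(u, v) \<in> arcs_ends G ^^ Suc l"
      by (rule relpow_Suc_I2[rotated])
  next
    assume "(u, v) \<in> arcs_ends G ^^ Suc l"
    then obtain w where w: "(u, w) \<in> arcs_ends G" "(w, v) \<in> arcs_ends G ^^ l"
      by (meson relpow_Suc_D2)
    then obtain e where e: "e \<in> arcs G" "u = tail G e" "w = head G e"
      by (auto simp: arcs_ends_def arc_to_ends_def)
    then obtain p where "awalk w p v" "length p = l"
      using w Suc.IH[of w] by auto
    then have "awalk u (e # p) v" "length (e # p) = Suc l"
      using e by (auto simp: awalk_Cons_iff)
    then show "\<exists>p. awalk u p v \<and> length p = Suc l" by blast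
  qed
qed

section \<open>Walks of prescribed length in Kneser graphs\<close>

lemma kneser_graph_simps:
  "pverts (kneser_graph m n) = {A. A \<subseteq> {1..m} \<and> card A = n}"
  "parcs (kneser_graph m n) =
    {(A, B). A \<in> pverts (kneser_graph m n) \<and> B \<in> pverts (kneser_graph m n) \<and> A \<inter> B = {}}"
  by (simp_all add: kneser_graph_def Let_def)

text \<open>Induction on the first step, to a neighbour \<open>x\<close> of \<open>u\<close>. The
  parity flips, so a bound on one of \<open>x - v\<close> and \<open>x \<inter> v\<close> must yield
  a bound on the other set for \<open>u\<close>.\<close>

lemma kneser_walk_necessary:
  assumes "u \<in> pverts (kneser_graph (2 * n + k) n)" "v \<in> pverts (kneser_graph (2 * n + k) n)"
    and "(u, v) \<in> parcs (kneser_graph (2 * n + k) n) ^^ l"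
  shows "(if even l then card (u - v) else card (u \<inter> v)) \<le> l div 2 * k"
  using assms
proof (induction l arbitrary: u)
  case 0
  then show ?case by simp
next
  case (Suc l)
  let ?G = "kneser_graph (2 * n + k) n"
  obtain x where ux: "(u, x) \<in> parcs ?G" and xv: "(x, v) \<in> parcs ?G ^^ l"
    using Suc.prems(3) by (meson relpow_Suc_D2)
  from ux have x: "x \<in> pverts ?G" and disj: "u \<inter> x = {}"
    by (auto simp: kneser_graph_simps(2))
  have IH: "(if even l then card (x - v) else card (x \<inter> v)) \<le> l div 2 * k"
    by (rule Suc.IH[OF x Suc.prems(2) xv])
  have sub: "u \<subseteq> {1..2*n+k}" "v \<subseteq> {1..2*n+k}" "x \<subseteq> {1..2*n+k}"
    and card: "card u = n" "card v = n" "card x = n"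
    using Suc.prems x by (auto simp: kneser_graph_simps(1))
  have fin: "finite u" "finite v" "finite x"
    using sub by (meson finite_atLeastAtMost finite_subset)+
  show ?case
  proof (cases "even l")
    case True
    have "card (u \<inter> v) \<le> card (v - x)"
      using disj fin by (intro card_mono) auto
    also have "\<dots> = card (x - v)"
      using card fin by (metis card_Diff_subset_Int Int_commute finite_Int)
    finally show ?thesis using True IH by simp
  next
    case False
    \<comment> \<open>\<open>u - v\<close> and \<open>x - v\<close> are disjoint and share the
      \<open>n + k\<close> elements outside \<open>v\<close>; this is the source of the gain of
      \<open>k\<close> per two steps.\<close>
    have "card (u - v) + card x \<le> card ((u - v) \<union> (x - v)) + card (x \<inter> v)"
      using disj fin card_Diff_subset_Int[of x v] card_mono[of x "x \<inter> v"]
      by (subst card_Un_disjoint) auto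
    moreover have "card ((u - v) \<union> (x - v)) \<le> card ({1..2*n+k} - v)"
      using sub by (intro card_mono) auto
    moreover have "card ({1..2*n+k} - v) = n + k"
      using sub fin card by (simp add: card_Diff_subset)
    ultimately have "card (u - v) \<le> k + card (x \<inter> v)"
      using card by simp
    then show ?thesis using False IH by simp
  qed
qed

text \<open>\<open>u \<union> v\<close> has at most \<open>n + k\<close> elements, which leaves room
  for a common neighbour.\<close>

lemma kneser_two_steps:
  assumes u: "u \<in> pverts (kneser_graph (2 * n + k) n)"
    and v: "v \<in> pverts (kneser_graph (2 * n + k) n)"
    and le: "card (u - v) \<le> k"
  shows "(u, v) \<in> parcs (kneser_graph (2 * n + k) n) ^^ 2"
proof -
  have sub: "u \<subseteq> {1..2*n+k}" "v \<subseteq> {1..2*n+k}" and card: "card u = n" "card v = n"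
    using u v by (auto simp: kneser_graph_simps(1))
  have fin: "finite u" "finite v"
    using sub by (meson finite_atLeastAtMost finite_subset)+
  have "card (u \<union> v) = card (u - v) + card v"
    using fin by (metis Un_Diff_cancel2 card_Un_disjoint Diff_disjoint Int_commute finite_Diff)
  then have "n \<le> card ({1..2*n+k} - (u \<union> v))"
    using sub fin card le by (subst card_Diff_subset) auto
  then obtain x where x: "x \<subseteq> {1..2*n+k} - (u \<union> v)" "card x = n"
    by (meson obtain_subset_with_card_n)
  then have "(u, x) \<in> parcs (kneser_graph (2 * n + k) n)"
    "(x, v) \<in> parcs (kneser_graph (2 * n + k) n)"
    using sub card by (auto simp: kneser_graph_simps)
  then show ?thesis
    by (auto simp: numeral_2_eq_2)
qed

lemma kneser_even_walk:
  assumes "u \<in> pverts (kneser_graph (2 * n + k) n)" "v \<in> pverts (kneser_graph (2 * n + k) n)"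
    and "card (u - v) \<le> m * k"
  shows "(u, v) \<in> parcs (kneser_graph (2 * n + k) n) ^^ (2 * m)"
  using assms
proof (induction m arbitrary: u)
  case 0
  then have fin: "finite u" "finite v" and card: "card u = card v"
    by (auto simp: kneser_graph_simps(1) intro: finite_subset)
  with 0 have "u \<subseteq> v" by simp
  then have "u = v" using fin card by (simp add: card_subset_eq)
  then show ?case by simp
next
  case (Suc m)
  let ?G = "kneser_graph (2 * n + k) n"
  have sub: "u \<subseteq> {1..2*n+k}" "v \<subseteq> {1..2*n+k}" and card: "card u = n" "card v = n"
    using Suc.prems by (auto simp: kneser_graph_simps(1))
  have fin: "finite u" "finite v"
    using sub by (meson finite_atLeastAtMost finite_subset)+
  \<comment> \<open>Two steps exchange as many elements as allowed, or all that are missing. In the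
    latter case \<open>w = v\<close>, and the remaining steps only use up the length.\<close>
  define j where "j = min k (card (u - v))"
  have eq: "card (v - u) = card (u - v)"
    using card fin by (metis card_Diff_subset_Int Int_commute finite_Int)
  obtain a where a: "a \<subseteq> u - v" "card a = j"
    by (metis obtain_subset_with_card_n j_def min.cobounded2)
  obtain b where b: "b \<subseteq> v - u" "card b = j"
    by (metis obtain_subset_with_card_n j_def min.cobounded2 eq)
  have finab: "finite a" "finite b"
    using a b fin by (meson finite_Diff finite_subset)+
  define w where "w = (u - a) \<union> b"
  have "card w = card (u - a) + card b"
    unfolding w_def using fin finab b by (intro card_Un_disjoint) auto
  also have "\<dots> = n"
  proof -
    have "a \<subseteq> u" using a by blast
    then show ?thesis
      using card_Diff_subset[OF finab(1)] card_mono[OF fin(1)] a(2) b(2) card(1)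
      by (metis le_add_diff_inverse2)
  qed
  finally have w: "w \<in> pverts ?G"
    using sub a b by (auto simp: kneser_graph_simps(1) w_def)
  have "u - w = a"
    using a b by (auto simp: w_def)
  then have "(u, w) \<in> parcs ?G ^^ 2"
    using a by (intro kneser_two_steps Suc.prems w) (simp add: j_def)
  moreover have "card (w - v) \<le> m * k"
  proof -
    have "w - v = (u - v) - a"
      using a b by (auto simp: w_def)
    then have "card (w - v) = card (u - v) - j"
      using a finab by (simp add: card_Diff_subset)
    then show ?thesis
      using Suc.prems(3) by (auto simp: j_def min_def)
  qed
  then have "(w, v) \<in> parcs ?G ^^ (2 * m)"
    by (intro Suc.IH Suc.prems w)
  ultimately have "(u, v) \<in> parcs ?G ^^ (2 + 2 * m)"
    unfolding relpow_add by blast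
  then show ?case by simp
qed

text \<open>The last vertex \<open>w\<close> before \<open>v\<close> is chosen as close to
  \<open>u\<close> as possible: it keeps \<open>u - v\<close> and replaces
  \<open>u \<inter> v\<close> by elements outside \<open>u \<union> v\<close>, of which there are
  \<open>card (u \<inter> v) + k\<close>. An even walk leads from \<open>u\<close> to
  \<open>w\<close>.\<close>

lemma kneser_odd_walk:
  assumes u: "u \<in> pverts (kneser_graph (2 * n + k) n)"
    and v: "v \<in> pverts (kneser_graph (2 * n + k) n)"
    and le: "card (u \<inter> v) \<le> m * k"
  shows "(u, v) \<in> parcs (kneser_graph (2 * n + k) n) ^^ (2 * m + 1)"
proof -
  let ?G = "kneser_graph (2 * n + k) n"
  have sub: "u \<subseteq> {1..2*n+k}" "v \<subseteq> {1..2*n+k}" and card: "card u = n" "card v = n"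
    using u v by (auto simp: kneser_graph_simps(1))
  have fin: "finite u" "finite v"
    using sub by (meson finite_atLeastAtMost finite_subset)+
  have "card (u \<union> v) + card (u \<inter> v) = 2 * n"
    using card_Un_Int[OF fin] card by simp
  then have "card (u \<inter> v) \<le> card ({1..2*n+k} - (u \<union> v))"
    using sub fin by (subst card_Diff_subset) auto
  then obtain b where b: "b \<subseteq> {1..2*n+k} - (u \<union> v)" "card b = card (u \<inter> v)"
    by (meson obtain_subset_with_card_n)
  have finb: "finite b"
    using b by (meson finite_Diff finite_atLeastAtMost finite_subset)
  define w where "w = (u - v) \<union> b"
  have "card w = card (u - v) + card b"
    unfolding w_def using fin finb b by (intro card_Un_disjoint) auto
  also have "\<dots> = n"
    using b fin card card_mono[of u "u \<inter> v"] by (simp add: card_Diff_subset_Int)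
  finally have w: "w \<in> pverts ?G"
    using sub b by (auto simp: kneser_graph_simps(1) w_def)
  have "u - w = u \<inter> v"
    using b by (auto simp: w_def)
  then have "(u, w) \<in> parcs ?G ^^ (2 * m)"
    using le by (intro kneser_even_walk u w) simp
  moreover have "(w, v) \<in> parcs ?G"
    using w v b by (auto simp: kneser_graph_simps(2) w_def)
  ultimately show ?thesis by auto
qed

lemma kneser_walk_iff:
  assumes "u \<in> pverts (kneser_graph (2 * n + k) n)" "v \<in> pverts (kneser_graph (2 * n + k) n)"
  shows "(u, v) \<in> parcs (kneser_graph (2 * n + k) n) ^^ l \<longleftrightarrow>
    (if even l then n \<le> card (u \<inter> v) + l div 2 * k else card (u \<inter> v) \<le> l div 2 * k)"
proof -
  have "finite u" "card u = n"
    using assms by (auto simp: kneser_graph_simps(1) intro: finite_subset)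
  then have "card (u - v) = n - card (u \<inter> v)"
    by (simp add: card_Diff_subset_Int)
  then have *: "card (u - v) \<le> l div 2 * k \<longleftrightarrow> n \<le> card (u \<inter> v) + l div 2 * k"
    by linarith
  show ?thesis
  proof (cases "even l")
    case True
    then show ?thesis
      using kneser_walk_necessary[OF assms, of l] kneser_even_walk[OF assms, of "l div 2"] *
      by auto
  next
    case False
    then show ?thesis
      using kneser_walk_necessary[OF assms, of l] kneser_odd_walk[OF assms, of "l div 2"]
      by auto
  qed
qed

section \<open>Distances and the diameter\<close>

lemma kneser_dist_le_iff:
  assumes "n > 0"
    and "u \<in> pverts (kneser_graph (2 * n + k) n)" "v \<in> pverts (kneser_graph (2 * n + k) n)"
  shows "graph_dist (with_proj (kneser_graph (2 * n + k) n)) u v \<le> enat d \<longleftrightarrow>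
    (\<exists>l\<le>d. if even l then n \<le> card (u \<inter> v) + l div 2 * k else card (u \<inter> v) \<le> l div 2 * k)"
proof -
  let ?G = "kneser_graph (2 * n + k) n"
  interpret pair_graph ?G by (rule pair_graph_kneser[OF assms(1)])
  have "graph_dist (with_proj ?G) u v \<le> enat d \<longleftrightarrow> (\<exists>l\<le>d. (u, v) \<in> parcs ?G ^^ l)"
    unfolding graph_dist_le_iff awalk_length_iff_relpow[OF assms(2), symmetric] by blast
  then show ?thesis
    by (simp only: kneser_walk_iff[OF assms(2,3)])
qed

text \<open>Within each parity the longest length up to \<open>e\<close> is the most permissive, so
  only \<open>2 * (e div 2)\<close> and the largest odd length matter. Writing \<open>s + k\<close>
  avoids a truncated subtraction.\<close>

lemma no_kneser_walk_iff:
  fixes n k s e :: nat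
  assumes "k > 0"
  shows "\<not> (\<exists>l\<le>e. if even l then n \<le> s + l div 2 * k else s \<le> l div 2 * k) \<longleftrightarrow>
    (e + 1) div 2 * k < s + k \<and> s + e div 2 * k < n"
proof
  assume none: "\<not> (\<exists>l\<le>e. if even l then n \<le> s + l div 2 * k else s \<le> l div 2 * k)"
  have "s + e div 2 * k < n"
    using none[simplified, rule_format, of "2 * (e div 2)"] by simp
  moreover have "(e + 1) div 2 * k < s + k"
  proof (cases "(e + 1) div 2")
    \<comment> \<open>Here \<open>e = 0\<close>: there is no odd length to exclude, and the bound
      \<open>0 < s + k\<close> holds trivially.\<close>
    case 0
    then show ?thesis using assms by simp
  next
    case (Suc m)
    then have "2 * m + 1 \<le> e" by linarith
    then show ?thesis
      using Suc none[simplified, rule_format, of "2 * m + 1"] by simp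
  qed
  ultimately show "(e + 1) div 2 * k < s + k \<and> s + e div 2 * k < n" by simp
next
  assume *: "(e + 1) div 2 * k < s + k \<and> s + e div 2 * k < n"
  show "\<not> (\<exists>l\<le>e. if even l then n \<le> s + l div 2 * k else s \<le> l div 2 * k)"
  proof clarify
    fix l assume l: "l \<le> e" and c: "if even l then n \<le> s + l div 2 * k else s \<le> l div 2 * k"
    show False
    proof (cases "even l")
      case True
      have "l div 2 * k \<le> e div 2 * k"
        using l by (intro mult_right_mono div_le_mono) auto
      moreover have "n \<le> s + l div 2 * k" using True c by simp
      ultimately show False using * by linarith
    next
      case False
      then have "l div 2 + 1 \<le> (e + 1) div 2" using l by presburger
      then have "(l div 2 + 1) * k \<le> (e + 1) div 2 * k"
        by (intro mult_right_mono) auto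
      moreover have "s \<le> l div 2 * k" using False c by simp
      ultimately show False using * unfolding add_mult_distrib mult_1 by linarith
    qed
  qed
qed

text \<open>If no length up to \<open>e + 1\<close> were feasible, adding the two strict bounds
  would cancel the intersection size and give \<open>e * k + 2 \<le> n\<close>.\<close>

lemma kneser_dist_le:
  assumes "n > 0" "k > 0" "n \<le> e * k + 1"
    and "u \<in> pverts (kneser_graph (2 * n + k) n)" "v \<in> pverts (kneser_graph (2 * n + k) n)"
  shows "graph_dist (with_proj (kneser_graph (2 * n + k) n)) u v \<le> enat (e + 1)"
proof -
  let ?s = "card (u \<inter> v)"
  have "(e + 1) div 2 + (e + 1 + 1) div 2 = e + 2 - 1"
    by presburger
  then have "(e + 1) div 2 * k + (e + 1 + 1) div 2 * k = e * k + k"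
    by (metis add.commute add_diff_cancel_right' add_mult_distrib mult_1 one_add_one add.assoc)
  then have "\<not> ((e + 1 + 1) div 2 * k < ?s + k \<and> ?s + (e + 1) div 2 * k < n)"
    using assms(3) by linarith
  then show ?thesis
    unfolding kneser_dist_le_iff[OF assms(1,4,5)] using no_kneser_walk_iff[OF assms(2), of "e + 1" n ?s] by blast
qed

text \<open>Supplies a pair attaining the diameter: an interval and its translate by
  \<open>n - s\<close>.\<close>

lemma kneser_vertices_with_intersection:
  assumes "s \<le> n"
  shows "\<exists>u v. u \<in> pverts (kneser_graph (2 * n + k) n) \<and> v \<in> pverts (kneser_graph (2 * n + k) n)
    \<and> card (u \<inter> v) = s"
proof (intro exI conjI)
  let ?u = "{1..n}" and ?v = "{n - s + 1..2 * n - s}"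
  show "?u \<in> pverts (kneser_graph (2 * n + k) n)" "?v \<in> pverts (kneser_graph (2 * n + k) n)"
    using assms by (auto simp: kneser_graph_simps(1))
  have "?u \<inter> ?v = {n - s + 1..n}"
    using assms by auto
  then show "card (?u \<inter> ?v) = s"
    using assms by simp
qed

lemma kneser_dist_eq_iff:
  assumes "n > 0" "k > 0" "n \<le> e * k + 1"
    and "u \<in> pverts (kneser_graph (2 * n + k) n)" "v \<in> pverts (kneser_graph (2 * n + k) n)"
  shows "graph_dist (with_proj (kneser_graph (2 * n + k) n)) u v = enat (e + 1) \<longleftrightarrow>
    (e + 1) div 2 * k < card (u \<inter> v) + k \<and> card (u \<inter> v) + e div 2 * k < n"
proof -
  let ?d = "graph_dist (with_proj (kneser_graph (2 * n + k) n)) u v"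
  have "?d \<le> enat (e + 1)"
    by (rule kneser_dist_le[OF assms])
  then have "?d = enat (e + 1) \<longleftrightarrow> \<not> ?d \<le> enat e"
    by (cases ?d) auto
  then show ?thesis
    unfolding kneser_dist_le_iff[OF assms(1,4,5)] no_kneser_walk_iff[OF assms(2)] .
qed

lemma kneser_diam:
  assumes "n > 0" "k > 0" and e: "n \<le> e * k + 1" "e * k + 1 < n + k"
  shows "graph_diam (with_proj (kneser_graph (2 * n + k) n)) = enat (e + 1)"
  unfolding graph_diam_def
proof (rule Max_eqI)
  let ?G = "with_proj (kneser_graph (2 * n + k) n)"
  let ?q = "(e + 1) div 2"
  have "finite (pverts (kneser_graph (2 * n + k) n))"
    unfolding kneser_graph_simps(1) by (rule finite_subset[of _ "Pow {1..2 * n + k}"]) auto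
  then have "finite ((\<lambda>(u, v). graph_dist ?G u v) ` (verts ?G \<times> verts ?G))"
    by simp
  then show "finite {graph_dist ?G u v |u v. u \<in> verts ?G \<and> v \<in> verts ?G}"
    by (rule rev_finite_subset) auto
  show "y \<le> enat (e + 1)" if "y \<in> {graph_dist ?G u v |u v. u \<in> verts ?G \<and> v \<in> verts ?G}" for y
    using that kneser_dist_le[OF assms(1-3)] by auto
  \<comment> \<open>The least size meeting the lower bound \<open>?q * k < s + k\<close>; the
    subtraction truncates to 0 when \<open>?q = 0\<close>.\<close>
  define s where "s = ?q * k + 1 - k"
  have "?q + e div 2 = e"
    by presburger
  then have "?q * k + e div 2 * k = e * k"
    by (metis add_mult_distrib)
  then have s: "?q * k < s + k" "s + e div 2 * k < n"
    using assms by (cases "?q"; force simp: s_def)+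
  then obtain u v where uv: "u \<in> pverts (kneser_graph (2 * n + k) n)"
    "v \<in> pverts (kneser_graph (2 * n + k) n)" "card (u \<inter> v) = s"
    using kneser_vertices_with_intersection[of s n k] by auto
  then have "graph_dist ?G u v = enat (e + 1)"
    using s kneser_dist_eq_iff[OF assms(1-3)] by blast
  then show "enat (e + 1) \<in> {graph_dist ?G u v |u v. u \<in> verts ?G \<and> v \<in> verts ?G}"
    using uv by (force simp: eq_commute)
qed

section \<open>The bounds in terms of \<open>H\<close> and the ceiling\<close>

text \<open>\<open>t = n - (e - 1) * k\<close> represents \<open>n\<close> modulo \<open>k\<close>
  in the window from 2 to \<open>k + 1\<close>, and \<open>H n k\<close> is \<open>t - 2\<close>.
  The first branch of \<open>H\<close> covers \<open>t = k\<close> and \<open>t = k + 1\<close>,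
  where the remainder wraps around.\<close>

lemma H_eq:
  assumes "k > 0" and e: "n \<le> e * k + 1" "e * k + 1 < n + k" and "e > 0"
  shows "H n k = int n - 2 - (int e - 1) * int k"
proof -
  obtain m where m: "e = Suc m"
    using \<open>e > 0\<close> gr0_conv_Suc by blast
  define t where "t = n - m * k"
  have n: "n = t + m * k" and t: "2 \<le> t" "t \<le> k + 1"
    using e by (auto simp: m t_def)
  have mod: "n mod k = t mod k"
    by (simp add: n)
  have "H n k = int t - 2"
  proof -
    consider "t < k" | "t = k" | "t = k + 1" using t by linarith
    then show ?thesis
    proof cases
      case 3
      then have "n mod k = 1 mod k"
        unfolding mod by (metis mod_add_self1)
      \<comment> \<open>For \<open>k = 1\<close> the remainder is 0 instead of 1, and the
        \<open>max\<close> in \<open>H\<close> lifts -1 to 0.\<close>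
      then show ?thesis
        using 3 t by (cases "k = 1") (auto simp: H_def)
    qed (use t mod in \<open>auto simp: H_def\<close>)
  qed
  then show ?thesis by (simp add: n m)
qed

theorem theorem1:
  fixes n k s :: nat and u v :: "nat set"
  assumes "n > 0" and "k > 0"
    and "u \<in> pverts (kneser_graph (2 * n + k) n)"
    and "v \<in> pverts (kneser_graph (2 * n + k) n)"
    and "u \<noteq> v"
    and "s = card (u \<inter> v)"
  shows "graph_dist (with_proj (kneser_graph (2 * n + k) n)) u v
           = graph_diam (with_proj (kneser_graph (2 * n + k) n))
    \<longleftrightarrow> (\<lceil>(real n - 1) / (2 * real k)\<rceil> - 1) * int k + 1 \<le> int s
      \<and> int s \<le> (\<lceil>(real n - 1) / (2 * real k)\<rceil> - 1) * int k + 1 + H n k"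
proof -
  \<comment> \<open>\<open>e\<close> is the rounded-up quotient of \<open>n - 1\<close> by \<open>k\<close>, and \<open>q\<close> that of \<open>n - 1\<close> by \<open>2 * k\<close>.\<close>
  define e where "e = (n + k - 2) div k"
  define q where "q = (e + 1) div 2"
  have mod: "e * k + (n + k - 2) mod k = n + k - 2" "(n + k - 2) mod k < k"
    using \<open>k > 0\<close> by (simp_all add: e_def)
  then have e: "n \<le> e * k + 1" "e * k + 1 < n + k"
    using \<open>n > 0\<close> \<open>k > 0\<close> by linarith+
  have q_e: "q + e div 2 = e" "2 * q \<le> e + 1" "e \<le> 2 * q"
    unfolding q_def by presburger+
  \<comment> \<open>Rounding up twice, by \<open>k\<close> and then by 2, agrees with rounding up
    once by \<open>2 * k\<close>.\<close>
  have "2 * q * k \<le> (e + 1) * k" "e * k \<le> 2 * q * k"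
    using q_e by (simp_all only: mult_le_mono1)
  then have "2 * q * k + 1 < n + 2 * k" "n \<le> 2 * q * k + 1"
    using e unfolding add_mult_distrib by linarith+
  then have "real (2 * q * k + 1) < real (n + 2 * k)" "real n \<le> real (2 * q * k + 1)"
    by (simp_all only: of_nat_less_iff of_nat_le_iff)
  then have ceil: "\<lceil>(real n - 1) / (2 * real k)\<rceil> = int q"
    using \<open>k > 0\<close> by (intro ceiling_unique) (simp_all add: field_simps)
  have "graph_dist (with_proj (kneser_graph (2 * n + k) n)) u v
           = graph_diam (with_proj (kneser_graph (2 * n + k) n))
    \<longleftrightarrow> q * k < s + k \<and> s + e div 2 * k < n"
    unfolding kneser_diam[OF assms(1,2) e] kneser_dist_eq_iff[OF assms(1,2) e(1) assms(3,4)]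
      q_def assms(6) ..
  also have "q * k < s + k \<longleftrightarrow> (int q - 1) * int k + 1 \<le> int s"
  proof -
    have "q * k < s + k \<longleftrightarrow> int q * int k < int s + int k"
      by (metis of_nat_add of_nat_less_iff of_nat_mult)
    then show ?thesis by (auto simp: algebra_simps)
  qed
  also have "s + e div 2 * k < n \<longleftrightarrow> int s \<le> (int q - 1) * int k + 1 + H n k"
  proof (cases "e = 0")
    case True
    then have "n = 1" "q = 0"
      using e \<open>n > 0\<close> by (auto simp: q_def)
    moreover have "H 1 k = int k - 1"
      using \<open>k > 0\<close> by (cases "k = 1") (auto simp: H_def)
    ultimately show ?thesis using True by simp
  next
    case False
    \<comment> \<open>Since \<open>e div 2 = e - q\<close>, the strict bound is
      \<open>s \<le> n - 1 - (e - q) * k\<close>, which is the right-hand side once \<open>H\<close>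
      is expanded.\<close>
    have "s + e div 2 * k < n \<longleftrightarrow> int s + (int e - int q) * int k < int n"
      using q_e(1) by (metis add_diff_cancel_left' of_nat_add of_nat_less_iff of_nat_mult)
    then show ?thesis
      using H_eq[OF assms(2) e] False by (auto simp: algebra_simps)
  qed
  finally show ?thesis by (simp only: ceil)
qed

end
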